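(* Let $T$ be an infinite, locally finite, spherically symmetric rooted tree, and for $n\in\mathbb{N}$ let $G_n$ be its $n$-th generation. Assume that $\lim_{n\to\infty}|G_n|=\infty$. For every $n$, let $U_n$ and $V_n$ be independent and uniformly distributed on $G_n$. Then: (1) for all $k\in\mathbb{N}$, $\lim_{n\to\infty}\mathbb{P}(d(U_n,V_n)\le k)=0$; (2) the sequence $(h(U_n\wedge V_n))_{n\in\mathbb{N}}$ is tight, that is, for every $\varepsilon>0$ there exists $k\in\mathbb{N}$ such that $\mathbb{P}(h(U_n\wedge V_n)>k)<\varepsilon$ for all $n$ large enough.
   Context: A rooted tree is spherically symmetric if for all $n\in\mathbb{N}$ every vertex of height $n$ has the same out-degree (number of children) $D_n$. The height $h(u)$ of a vertex is its graph distance to the root, $G_n$ is the set of vertices of height $n$, $u\wedge v$ is the latest common ancestor of $u$ and $v$, $d(u,v)=h(u)+h(v)-2h(u\wedge v)$ is the graph distance, and $|\cdot|$ denotes cardinality. Locally finite means that all vertices have finite degree. *)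

theory Defs
  imports "HOL-Probability.Probability" "Graph_Theory.Digraph_Component"
begin

text \<open>
  A simple undirected graph, possibly infinite, is a symmetric loop-free digraph without
  parallel arcs (locale \<open>pair_bidirected_digraph\<close>), each edge being a pair of opposite arcs.
  In this encoding \<open>u, v, u\<close> is a directed \<open>cycle\<close> for every edge, so the library
  predicates \<open>forest\<close> and \<open>tree\<close> do not express undirected acyclicity. The
  cycles of the undirected graph are exactly the directed cycles of length at least 3.
\<close>

locale rooted_tree = pair_bidirected_digraph T for T :: "'v pair_pre_digraph" +
  fixes root :: 'v
  assumes root_in_verts: "root \<in> pverts T"
    and tree_connected: "Digraph_Component.connected (with_proj T)"
    and tree_acyclic: "\<nexists>p. cycle p \<and> 3 \<le> length p"
begin

definition tree_dist :: "'v \<Rightarrow> 'v \<Rightarrow> nat" where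
  "tree_dist u v = (LEAST n. \<exists>p. awalk u p v \<and> length p = n)"

definition height :: "'v \<Rightarrow> nat" where
  "height v = tree_dist root v"

definition generation :: "nat \<Rightarrow> 'v set" where
  "generation n = {v \<in> pverts T. height v = n}"

definition children :: "'v \<Rightarrow> 'v set" where
  "children v = {w. (v, w) \<in> parcs T \<and> height w = Suc (height v)}"

definition locally_finite :: bool where
  "locally_finite \<longleftrightarrow> (\<forall>v \<in> pverts T. finite (out_arcs (with_proj T) v))"

definition spherically_symmetric :: bool where
  "spherically_symmetric \<longleftrightarrow>
     (\<exists>D :: nat \<Rightarrow> nat. \<forall>n. \<forall>v \<in> generation n. finite (children v) \<and> card (children v) = D n)"

text \<open>Every vertex is an ancestor of itself.\<close>

definition ancestor :: "'v \<Rightarrow> 'v \<Rightarrow> bool" where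
  "ancestor w v \<longleftrightarrow> (\<exists>p. apath root p v \<and> w \<in> set (pawalk_verts root p))"

text \<open>
  For vertices \<open>u\<close> and \<open>v\<close> the maximiser is unique, since the ancestors of \<open>u\<close>
  have pairwise distinct heights.
\<close>

definition latest_common_ancestor :: "'v \<Rightarrow> 'v \<Rightarrow> 'v" where
  "latest_common_ancestor u v = (ARG_MAX height w. ancestor w u \<and> ancestor w v)"

end

end

theory Submission
  imports Defs
begin

text \<open>
  By spherical symmetry all vertices of \<open>G\<^sub>j\<close> have equally many descendants in \<open>G\<^sub>n\<close>, so
  for \<open>j \<le> n\<close> the ancestors of \<open>U\<^sub>n\<close> and \<open>V\<^sub>n\<close> at height \<open>j\<close> are independent and uniform on
  \<open>G\<^sub>j\<close> and agree with probability \<open>1 / |G\<^sub>j|\<close>. If \<open>h(U\<^sub>n \<and> V\<^sub>n) > k\<close>, they agree at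
  height \<open>k + 1\<close>. If \<open>d(U\<^sub>n, V\<^sub>n) \<le> k\<close>, a geodesic between them stays at height at least
  \<open>n - k\<close>, so they agree at height \<open>n - k\<close>.

  That every vertex but the root has a unique parent, and that heights differ by one along every
  edge, both follow from acyclicity: two distinct vertices of the same generation are joined by a
  path through lower vertices, which an edge between them or a common child would close to a cycle.
\<close>

context rooted_tree
begin

section \<open>Walks, distances and heights\<close>

lemma reachable_by_awalk:
  assumes "u \<in> pverts T" "v \<in> pverts T"
  shows "\<exists>p. awalk u p v"
proof -
  have "strongly_connected (with_proj T)"
    using symmetric_connected_imp_strongly_connected tree_connected sym_arcs by simp
  then have "u \<rightarrow>\<^sup>*\<^bsub>with_proj T\<^esub> v"
    using assms by (auto simp: strongly_connected_def)
  then show ?thesis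
    using reachable_awalk by blast
qed

lemma tree_dist_awalk:
  assumes "u \<in> pverts T" "v \<in> pverts T"
  shows "\<exists>p. awalk u p v \<and> length p = tree_dist u v"
  unfolding tree_dist_def
  by (rule LeastI_ex) (use reachable_by_awalk[OF assms] in blast)

lemma tree_dist_le: "awalk u p v \<Longrightarrow> tree_dist u v \<le> length p"
  unfolding tree_dist_def by (rule Least_le) blast

lemma height_root [simp]: "height root = 0"
  using tree_dist_le[of root "[]" root] root_in_verts by (simp add: height_def awalk_Nil_iff)

lemma height_eq_0_iff:
  assumes "v \<in> pverts T"
  shows "height v = 0 \<longleftrightarrow> v = root"
proof
  assume "height v = 0"
  then have "awalk root [] v"
    using tree_dist_awalk[OF root_in_verts assms] by (simp add: height_def)
  then show "v = root"
    by (simp add: awalk_Nil_iff)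
qed simp

lemma height_arc_le:
  assumes "(u, v) \<in> parcs T"
  shows "height v \<le> Suc (height u)"
proof -
  obtain p where p: "awalk root p u" "length p = height u"
    using tree_dist_awalk[OF root_in_verts in_arcsD1[OF assms]] by (auto simp: height_def)
  have "awalk u [(u, v)] v"
    using arc_implies_awalk[OF assms] by simp
  with p(1) have "awalk root (p @ [(u, v)]) v"
    by (rule awalk_appendI)
  from tree_dist_le[OF this] p(2) show ?thesis
    by (simp add: height_def)
qed

text \<open>Arcs are symmetric, so one step along the walk lowers the height by at most one, and
  \<open>z\<close> is reached after at most \<open>length p\<close> steps.\<close>

lemma height_awalk_le: "awalk x p y \<Longrightarrow> z \<in> set (pawalk_verts x p) \<Longrightarrow> height x \<le> height z + length p"
proof (induction p arbitrary: x)
  case (Cons e p)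
  obtain u v where e: "e = (u, v)" by (cases e)
  have "x = u" "(u, v) \<in> parcs T" "awalk v p y"
    using Cons.prems e by (auto simp: awalk_Cons_iff)
  moreover have "height u \<le> Suc (height v)"
    using height_arc_le[OF arcs_symmetric] \<open>(u, v) \<in> parcs T\<close> by blast
  ultimately show ?case
    using Cons.IH[of v] Cons.prems(2) e by auto
qed auto

text \<open>The last arc of a shortest walk from \<open>root\<close> to \<open>v\<close> starts at
  such a vertex: the rest of the walk bounds its height by \<open>n\<close> from above, and
  \<open>height_arc_le\<close> for the last arc bounds it from below.\<close>

lemma exists_parent:
  assumes "v \<in> pverts T" "height v = Suc n"
  shows "\<exists>u. (u, v) \<in> parcs T \<and> height u = n"
proof -
  obtain p where p: "awalk root p v" "length p = Suc n"
    using tree_dist_awalk[OF root_in_verts assms(1)] assms(2) by (auto simp: height_def)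
  then obtain q e where q: "p = q @ [e]" "length q = n"
    by (metis length_Suc_conv_rev)
  obtain u w where e: "e = (u, w)" by (cases e)
  define l where "l = awlast root q"
  have "awalk root q l" "awalk l [e] v"
    using p(1) q(1) awalk_append_iff[of root q "[e]" v] unfolding l_def by auto
  then have 1: "awalk root q u" "w = v" "(u, v) \<in> parcs T"
    using e by (auto simp: awalk_simps)
  have "height u \<le> n"
    using tree_dist_le[OF 1(1)] q(2) by (simp add: height_def)
  moreover have "n \<le> height u"
    using height_arc_le[OF 1(3)] assms(2) by simp
  ultimately show ?thesis
    using 1(3) by auto
qed

section \<open>Consequences of acyclicity\<close>

lemma apath_snoc:
  assumes "apath x p y" "(y, z) \<in> parcs T" "z \<notin> set (pawalk_verts x p)"
  shows "apath x (p @ [(y, z)]) z" "pawalk_verts x (p @ [(y, z)]) = pawalk_verts x p @ [z]"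
proof -
  have w: "awalk y [(y, z)] z"
    using arc_implies_awalk[OF assms(2)] by simp
  have p: "awalk x p y"
    using assms(1) by (simp add: apath_def)
  have a: "awalk x (p @ [(y, z)]) z"
    using awalk_appendI[OF p w] .
  show v: "pawalk_verts x (p @ [(y, z)]) = pawalk_verts x p @ [z]"
    using awalk_verts_append[OF a] p by simp
  show "apath x (p @ [(y, z)]) z"
    using a v assms by (simp add: apath_def)
qed

text \<open>Step down from \<open>x\<close> and \<open>y\<close> to arbitrary parents, join these by
  the induction hypothesis, or by the empty path if they coincide, and step up again. The inner path
  stays at height at most \<open>n\<close>, so it avoids \<open>x\<close> and
  \<open>y\<close>.\<close>

lemma apath_below_generation:
  assumes "x \<in> generation n" "y \<in> generation n" "x \<noteq> y"
  shows "\<exists>p. apath x p y \<and> 2 \<le> length p \<and> (\<forall>z \<in> set (pawalk_verts x p). height z \<le> n)"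
  using assms
proof (induction n arbitrary: x y)
  case 0
  then show ?case
    using height_eq_0_iff by (auto simp: generation_def)
next
  case (Suc n)
  have xy: "x \<in> pverts T" "height x = Suc n" "y \<in> pverts T" "height y = Suc n"
    using Suc.prems by (auto simp: generation_def)
  obtain x' where x': "(x', x) \<in> parcs T" "height x' = n"
    using exists_parent xy by blast
  obtain y' where y': "(y', y) \<in> parcs T" "height y' = n"
    using exists_parent xy by blast
  have g: "x' \<in> generation n" "y' \<in> generation n"
    using x' y' in_arcsD1 by (auto simp: generation_def)
  have xx: "(x, x') \<in> parcs T"
    using x' arcs_symmetric by blast
  obtain q where q: "apath x' q y'" "\<forall>z \<in> set (pawalk_verts x' q). height z \<le> n"
    "x' = y' \<or> 2 \<le> length q"
  proof (cases "x' = y'")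
    case True
    then show ?thesis
      using that[of "[]"] g by (simp add: apath_Nil_iff generation_def)
  next
    case False
    then show ?thesis
      using Suc.IH[OF g] that by blast
  qed
  have y_notin: "y \<notin> set (pawalk_verts x' q)" and x_notin: "x \<notin> set (pawalk_verts x' q)"
    using q(2) xy by auto
  note s = apath_snoc[OF q(1) y'(1) y_notin]
  have "apath x ((x, x') # q @ [(y', y)]) y"
    using s x_notin xx Suc.prems(3) by (auto simp: apath_Cons_iff)
  moreover have "\<forall>z \<in> set (pawalk_verts x ((x, x') # q @ [(y', y)])). height z \<le> Suc n"
    using s q(2) xy by auto
  moreover have "2 \<le> length ((x, x') # q @ [(y', y)])"
    by simp
  ultimately show ?case
    by blast
qed

text \<open>The arc would close the path to a cycle with at least three arcs. A path of length 1
  would only give an edge traversed back and forth, which \<open>tree_acyclic\<close>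
  permits.\<close>

lemma apath_closing_arc:
  assumes "apath x p y" "2 \<le> length p"
  shows "(y, x) \<notin> parcs T"
proof
  assume "(y, x) \<in> parcs T"
  moreover have w: "awalk x p y" and d: "distinct (pawalk_verts x p)"
    using assms(1) by (auto simp: apath_def)
  ultimately have "awalk y ((y, x) # p) y" "distinct (tl (pawalk_verts y ((y, x) # p)))"
    by (auto simp: awalk_Cons_iff)
  then have "cycle ((y, x) # p)"
    unfolding cycle_def by blast
  moreover have "3 \<le> length ((y, x) # p)"
    using assms(2) by simp
  ultimately show False
    using tree_acyclic by blast
qed

lemma arc_height_neq:
  assumes "(x, y) \<in> parcs T"
  shows "height x \<noteq> height y"
proof
  assume eq: "height x = height y"
  have "x \<in> generation (height x)" "y \<in> generation (height x)" "x \<noteq> y"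
    using assms eq wellformed' no_loops[OF assms] by (auto simp: generation_def)
  then obtain p where "apath x p y" "2 \<le> length p"
    using apath_below_generation by blast
  then show False
    using apath_closing_arc arcs_symmetric assms by blast
qed

lemma parent_unique:
  assumes "(x, v) \<in> parcs T" "(y, v) \<in> parcs T" "height v = Suc (height x)" "height v = Suc (height y)"
  shows "x = y"
proof (rule ccontr)
  assume neq: "x \<noteq> y"
  have "x \<in> generation (height x)" "y \<in> generation (height x)"
    using assms wellformed' by (auto simp: generation_def)
  then obtain p where p: "apath x p y" "2 \<le> length p" "\<forall>z \<in> set (pawalk_verts x p). height z \<le> height x"
    using apath_below_generation neq by blast
  \<comment> \<open>The path stays strictly below the height of \<open>v\<close>, so it can be
    prolonged to \<open>v\<close>, and the arc from \<open>v\<close> back to \<open>x\<close> closes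
    it.\<close>
  have "v \<notin> set (pawalk_verts x p)"
    using p(3) assms(3) by auto
  then have "apath x (p @ [(y, v)]) v"
    using apath_snoc p(1) assms(2) by blast
  moreover have "2 \<le> length (p @ [(y, v)])"
    using p(2) by simp
  ultimately show False
    using apath_closing_arc arcs_symmetric assms(1) by blast
qed

section \<open>Parents and ancestors at a given height\<close>

text \<open>No \<open>u\<close> meets the condition when \<open>v\<close> is the root, so
  \<open>parent root\<close> is an unspecified value.\<close>

definition parent :: "'v \<Rightarrow> 'v" where
  "parent v = (SOME u. (u, v) \<in> parcs T \<and> height v = Suc (height u))"

text \<open>For \<open>j > height v\<close> the truncated subtraction makes this \<open>v\<close>
  itself; it is an ancestor at height \<open>j\<close> only for
  \<open>j \<le> height v\<close>.\<close>

definition ancestor_at :: "nat \<Rightarrow> 'v \<Rightarrow> 'v" where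
  "ancestor_at j v = (parent ^^ (height v - j)) v"

lemma parent_eq: "(u, v) \<in> parcs T \<Longrightarrow> height v = Suc (height u) \<Longrightarrow> parent v = u"
  unfolding parent_def by (rule some_equality) (auto intro: parent_unique)

lemma parent_arc:
  assumes "v \<in> generation (Suc n)"
  shows "(parent v, v) \<in> parcs T" "parent v \<in> generation n"
proof -
  obtain u where "(u, v) \<in> parcs T" "height u = n"
    using exists_parent[of v n] assms by (auto simp: generation_def)
  moreover have "parent v = u"
    using calculation assms by (intro parent_eq) (auto simp: generation_def)
  ultimately show "(parent v, v) \<in> parcs T" "parent v \<in> generation n"
    using in_arcsD1 by (auto simp: generation_def)
qed

text \<open>\<open>height_arc_le\<close> in both directions bounds the height difference by one, and
  \<open>arc_height_neq\<close> excludes zero.\<close>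

lemma arc_cases:
  assumes "(x, y) \<in> parcs T"
  obtains "height y = Suc (height x)" "parent y = x"
    | "height x = Suc (height y)" "parent x = y"
proof -
  have "(y, x) \<in> parcs T"
    using assms arcs_symmetric by blast
  moreover have "height y = Suc (height x) \<or> height x = Suc (height y)"
    using height_arc_le[OF assms] height_arc_le[OF calculation] arc_height_neq[OF assms] by linarith
  ultimately show thesis
    using parent_eq assms that by blast
qed

lemma ancestor_at_self [simp]: "ancestor_at (height v) v = v"
  by (simp add: ancestor_at_def)

lemma ancestor_at_parent:
  assumes "height v = Suc n" "height (parent v) = n" "j \<le> n"
  shows "ancestor_at j v = ancestor_at j (parent v)"
  using assms by (simp add: ancestor_at_def Suc_diff_le funpow_swap1)

lemma ancestor_at_generation:
  "v \<in> generation n \<Longrightarrow> j \<le> n \<Longrightarrow> ancestor_at j v \<in> generation j"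
proof (induction n arbitrary: v)
  case (Suc n)
  show ?case
  proof (cases "j = Suc n")
    case True
    then show ?thesis
      using Suc.prems ancestor_at_self[of v] by (simp add: generation_def)
  next
    case False
    then show ?thesis
      using Suc parent_arc(2)[of v n] ancestor_at_parent[of v n j] by (auto simp: generation_def)
  qed
qed (auto simp: generation_def ancestor_at_def)

lemma ancestor_at_ancestor_at:
  "v \<in> generation n \<Longrightarrow> i \<le> n \<Longrightarrow> j \<le> i \<Longrightarrow> ancestor_at j (ancestor_at i v) = ancestor_at j v"
proof (induction n arbitrary: v)
  case (Suc n)
  have h: "height v = Suc n" "height (parent v) = n"
    using Suc.prems(1) parent_arc(2)[of v n] by (auto simp: generation_def)
  show ?case
  proof (cases "i = Suc n")
    case True
    then show ?thesis
      using h ancestor_at_self[of v] by simp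
  next
    case False
    then show ?thesis
      using Suc parent_arc(2)[of v n] ancestor_at_parent[OF h] by auto
  qed
qed (auto simp: generation_def ancestor_at_def)

section \<open>Ancestors along walks, and the latest common ancestor\<close>

lemma ancestor_at_arc:
  assumes "(x, y) \<in> parcs T" "j \<le> height x" "j \<le> height y"
  shows "ancestor_at j x = ancestor_at j y"
  using assms(1)
proof (cases rule: arc_cases)
  case 1
  then show ?thesis
    using ancestor_at_parent[of y "height x" j] assms(2) by simp
next
  case 2
  then show ?thesis
    using ancestor_at_parent[of x "height y" j] assms(3) by simp
qed

text \<open>Each arc joins a parent and a child, both at height at least \<open>j\<close>, so the
  ancestor at height \<open>j\<close> is invariant along the walk.\<close>

lemma ancestor_at_awalk:
  "awalk x p y \<Longrightarrow> \<forall>z \<in> set (pawalk_verts x p). j \<le> height z \<Longrightarrow> ancestor_at j x = ancestor_at j y"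
proof (induction p arbitrary: x)
  case (Cons e p)
  obtain u v where e: "e = (u, v)" by (cases e)
  have *: "x = u" "(u, v) \<in> parcs T" "awalk v p y"
    using Cons.prems e by (auto simp: awalk_Cons_iff)
  have "v \<in> set (pawalk_verts v p)"
    using hd_in_awalk_verts(1)[OF *(3)] .
  then have "ancestor_at j u = ancestor_at j v"
    using ancestor_at_arc[OF *(2)] Cons.prems(2) e by auto
  then show ?case
    using Cons.IH[OF *(3)] Cons.prems(2) e *(1) by auto
qed (auto simp: awalk_Nil_iff)

text \<open>For \<open>k \<ge> n\<close> the truncated difference is 0, and both sides are the
  root.\<close>

lemma ancestor_at_eq_if_tree_dist_le:
  assumes "x \<in> generation n" "y \<in> generation n" "tree_dist x y \<le> k"
  shows "ancestor_at (n - k) x = ancestor_at (n - k) y"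
proof -
  obtain p where p: "awalk x p y" "length p \<le> k"
    using tree_dist_awalk[of x y] assms by (auto simp: generation_def)
  have "n - k \<le> height z" if "z \<in> set (pawalk_verts x p)" for z
    using height_awalk_le[OF p(1) that] p(2) assms(1) by (auto simp: generation_def)
  then show ?thesis
    using ancestor_at_awalk[OF p(1)] by blast
qed

text \<open>
  A path that starts at the root never turns back: after an ascending step from the parent of
  \<open>x\<close> to \<open>x\<close>, a descending step would revisit the parent.
\<close>

lemma apath_ascending:
  assumes "apath u p v" "u = root \<or> parent u \<notin> set (pawalk_verts u p)" "w \<in> set (pawalk_verts u p)"
  shows "height w \<le> height v \<and> ancestor_at (height w) v = w"
  using assms
proof (induction p arbitrary: u w)
  case Nil
  then show ?case
    by (auto simp: apath_Nil_iff)
next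
  case (Cons e p)
  obtain x where e: "e = (u, x)" and arc: "(u, x) \<in> parcs T" and p: "apath x p v"
    and u: "u \<notin> set (pawalk_verts x p)"
    using Cons.prems(1) by (cases e) (auto simp: apath_Cons_iff)
  have x: "x \<in> set (pawalk_verts x p)"
    using hd_in_awalk_verts(2)[OF p] .
  show ?case
    using arc
  proof (cases rule: arc_cases)
    case 1
    then have IH: "height z \<le> height v \<and> ancestor_at (height z) v = z"
      if "z \<in> set (pawalk_verts x p)" for z
      using Cons.IH[OF p _ that] u by simp
    have v: "v \<in> generation (height v)"
      using p awalk_last_in_verts by (auto simp: apath_def generation_def)
    have "ancestor_at (height u) v = ancestor_at (height u) x"
      using ancestor_at_ancestor_at[OF v, of "height x" "height u"] IH[OF x] 1 by simp
    also have "\<dots> = u"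
      using ancestor_at_parent[of x "height u" "height u"] 1 by simp
    finally show ?thesis
      using Cons.prems(3) IH IH[OF x] 1 e by auto
  next
    case 2
    then show ?thesis
      using Cons.prems(2) x e by auto
  qed
qed

text \<open>Translates ancestry defined by paths into iterated parents. A path from the root
  satisfies the first disjunct in \<open>apath_ascending\<close>.\<close>

lemma ancestor_eq_ancestor_at:
  "ancestor w v \<Longrightarrow> height w \<le> height v \<and> ancestor_at (height w) v = w"
  unfolding ancestor_def using apath_ascending by blast

lemma ancestor_root: "v \<in> pverts T \<Longrightarrow> ancestor root v"
  unfolding ancestor_def
  using reachable_by_awalk[OF root_in_verts] apath_awalk_to_apath hd_in_awalk_verts(2) by blast

text \<open>The maximum in \<open>ARG_MAX\<close> is attained: the root is a common ancestor, and
  all common ancestors have height at most \<open>height u\<close>. The \<open>Suc\<close> makes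
  this bound strict, as \<open>arg_max_natI\<close> requires.\<close>

lemma latest_common_ancestor_is_ancestor:
  assumes "u \<in> pverts T" "v \<in> pverts T"
  shows "ancestor (latest_common_ancestor u v) u \<and> ancestor (latest_common_ancestor u v) v"
  unfolding latest_common_ancestor_def
proof (rule arg_max_natI)
  show "ancestor root u \<and> ancestor root v"
    using ancestor_root assms by blast
  show "\<forall>w. ancestor w u \<and> ancestor w v \<longrightarrow> height w < Suc (height u)"
    using ancestor_eq_ancestor_at by (auto simp: less_Suc_eq_le)
qed

text \<open>Both ancestral lines pass through \<open>?w\<close>, so both sides equal
  \<open>ancestor_at j ?w\<close>.\<close>

lemma ancestor_at_eq_if_latest_common_ancestor:
  assumes "u \<in> pverts T" "v \<in> pverts T" "j \<le> height (latest_common_ancestor u v)"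
  shows "ancestor_at j u = ancestor_at j v"
proof -
  let ?w = "latest_common_ancestor u v"
  have "ancestor_at j x = ancestor_at j ?w" if "ancestor ?w x" "x \<in> pverts T" for x
    using ancestor_at_ancestor_at[of x "height x" "height ?w" j] ancestor_eq_ancestor_at[OF that(1)]
      that(2) assms(3) by (simp add: generation_def)
  then show ?thesis
    using latest_common_ancestor_is_ancestor[OF assms(1,2)] assms(1,2) by metis
qed

section \<open>Counting descendants\<close>

lemma children_eq: "v \<in> generation n \<Longrightarrow> children v = {w \<in> generation (Suc n). parent w = v}"
  using parent_arc(1) parent_eq in_arcsD2 by (fastforce simp: children_def generation_def)

lemma generation_0: "generation 0 = {root}"
  using height_eq_0_iff root_in_verts by (auto simp: generation_def)

text \<open>The recursion behind \<open>card_descendants\<close>: since \<open>j \<le> n\<close>, a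
  vertex of generation \<open>Suc n\<close> and its parent have the same ancestor at height
  \<open>j\<close>.\<close>

lemma descendants_Suc:
  assumes "j \<le> n"
  shows "{v \<in> generation (Suc n). ancestor_at j v = w} =
    (\<Union>u \<in> {u \<in> generation n. ancestor_at j u = w}. children u)" (is "?L = ?R")
proof -
  have *: "parent v \<in> generation n" "ancestor_at j v = ancestor_at j (parent v)"
    if "v \<in> generation (Suc n)" for v
    using parent_arc(2)[OF that] ancestor_at_parent[of v n j] that assms by (auto simp: generation_def)
  show ?thesis
  proof
    show "?L \<subseteq> ?R"
    proof
      fix v
      assume "v \<in> ?L"
      then have "v \<in> children (parent v)" "parent v \<in> {u \<in> generation n. ancestor_at j u = w}"
        using * by (auto simp: children_eq[OF *(1)])
      then show "v \<in> ?R" by blast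
    qed
    show "?R \<subseteq> ?L"
      using * by (auto simp: children_eq)
  qed
qed

lemma finite_generation:
  assumes "spherically_symmetric"
  shows "finite (generation n)"
proof (induction n)
  case (Suc n)
  have "generation (Suc n) \<subseteq> (\<Union>u \<in> generation n. children u)"
    using parent_arc(2) by (auto simp: children_eq)
  then show ?case
    using Suc assms finite_subset unfolding spherically_symmetric_def by blast
qed (simp add: generation_0)

lemma card_descendants:
  assumes "spherically_symmetric"
  shows "\<exists>N. \<forall>w \<in> generation j. card {v \<in> generation (j + m). ancestor_at j v = w} = N"
proof -
  obtain D where D: "finite (children v) \<and> card (children v) = D n" if "v \<in> generation n" for v n
    using assms unfolding spherically_symmetric_def by blast
  \<comment> \<open>Each generation multiplies the count by its out-degree, so the product depends
    on \<open>j\<close> and \<open>m\<close> but not on \<open>w\<close>.\<close>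
  have "card {v \<in> generation (j + m). ancestor_at j v = w} = (\<Prod>i<m. D (j + i))"
    if w: "w \<in> generation j" for w
  proof (induction m)
    case 0
    have "{v \<in> generation j. ancestor_at j v = w} = {w}"
      using w by (auto simp: generation_def ancestor_at_def)
    then show ?case by simp
  next
    case (Suc m)
    let ?A = "{u \<in> generation (j + m). ancestor_at j u = w}"
    have "card (\<Union>u \<in> ?A. children u) = (\<Sum>u \<in> ?A. card (children u))"
    proof (rule card_UN_disjoint)
      show "finite ?A"
        using finite_generation[OF assms] by simp
      show "\<forall>u\<in>?A. finite (children u)"
        using D by blast
      \<comment> \<open>By \<open>children_eq\<close> these sets are fibres of
        \<open>parent\<close>.\<close>
      show "\<forall>u\<in>?A. \<forall>v\<in>?A. u \<noteq> v \<longrightarrow> children u \<inter> children v = {}"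
        by (auto simp: children_eq)
    qed
    also have "\<dots> = (\<Sum>u \<in> ?A. D (j + m))"
      using D by (intro sum.cong) auto
    finally show ?case
      using Suc descendants_Suc[of j "j + m" w] by simp
  qed
  then show ?thesis by blast
qed

end

section \<open>Independent uniform variables under a map with fibres of equal size\<close>

lemma (in prob_space) prob_uniform_vimage:
  assumes "X \<in> measurable M (count_space G)" "finite G"
    and "distr M (count_space G) X = uniform_count_measure G" "A \<subseteq> G"
  shows "prob (X -` A \<inter> space M) = card A / card G"
proof -
  have "prob (X -` A \<inter> space M) = measure (distr M (count_space G) X) A"
    using assms(1,4) by (simp add: measure_distr)
  also have "\<dots> = card A / card G"
    using assms(2-4) by (simp add: measure_uniform_count_measure)
  finally show ?thesis .
qed

text \<open>The event splits over \<open>w\<close> in \<open>H\<close> according to the common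
  image. Each piece has probability \<open>(N / card G)^2\<close> by independence, and
  \<open>card G = card H * N\<close>.\<close>

lemma (in prob_space) prob_equal_image_of_uniform:
  assumes indep: "indep_var (count_space G) X (count_space G) Y"
    and X: "distr M (count_space G) X = uniform_count_measure G"
    and Y: "distr M (count_space G) Y = uniform_count_measure G"
    and fin: "finite G" "finite H" and f: "f ` G \<subseteq> H"
    and fibres: "\<And>w. w \<in> H \<Longrightarrow> card {v \<in> G. f v = w} = N"
  shows "{\<omega> \<in> space M. f (X \<omega>) = f (Y \<omega>)} \<in> events"
    and "\<P>(\<omega> in M. f (X \<omega>) = f (Y \<omega>)) = 1 / card H"
proof -
  have mX: "X \<in> measurable M (count_space G)" and mY: "Y \<in> measurable M (count_space G)"
    using indep_var_rv1[OF indep] indep_var_rv2[OF indep] by auto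
  have XG: "X \<omega> \<in> G" and YG: "Y \<omega> \<in> G" if "\<omega> \<in> space M" for \<omega>
    using measurable_space[OF mX that] measurable_space[OF mY that] by auto
  define F where "F w = {v \<in> G. f v = w}" for w
  \<comment> \<open>The preimage of a product is the form that \<open>indep_varD\<close> expects;
    \<open>E_eq\<close> rewrites it for measurability.\<close>
  define E where "E w = (\<lambda>\<omega>. (X \<omega>, Y \<omega>)) -` (F w \<times> F w) \<inter> space M" for w
  have E_eq: "E w = (X -` F w \<inter> space M) \<inter> (Y -` F w \<inter> space M)" for w
    by (auto simp: E_def)
  have E_ev: "E w \<in> events" for w
    unfolding E_eq using mX mY by (intro sets.Int measurable_sets) (auto simp: F_def)
  have un: "{\<omega> \<in> space M. f (X \<omega>) = f (Y \<omega>)} = (\<Union>w\<in>H. E w)"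
    using XG YG f by (fastforce simp: E_def F_def)
  then show "{\<omega> \<in> space M. f (X \<omega>) = f (Y \<omega>)} \<in> events"
    using E_ev fin(2) by auto
  \<comment> \<open>The space is nonempty, so \<open>X\<close> takes a value in \<open>G\<close>.
    With \<open>card_G\<close> this makes \<open>card H\<close> and \<open>N\<close> nonzero, which
    the final cancellation uses.\<close>
  have G: "card G \<noteq> 0"
    using XG not_empty fin(1) by fastforce
  have "card G = card (\<Union>w\<in>H. F w)"
    using f by (intro arg_cong[where f = card]) (auto simp: F_def)
  also have "\<dots> = (\<Sum>w\<in>H. card (F w))"
    using fin by (intro card_UN_disjoint) (auto simp: F_def)
  finally have card_G: "card G = card H * N"
    using fibres by (simp add: F_def)
  have "prob (E w) = (N / card G) * (N / card G)" if "w \<in> H" for w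
  proof -
    have "prob (E w) = prob (X -` F w \<inter> space M) * prob (Y -` F w \<inter> space M)"
      unfolding E_def by (rule indep_varD[OF indep]) (auto simp: F_def)
    then show ?thesis
      using prob_uniform_vimage[OF mX fin(1) X, of "F w"] prob_uniform_vimage[OF mY fin(1) Y, of "F w"]
        fibres[OF that] by (simp add: F_def)
  qed
  moreover have "prob (\<Union>w\<in>H. E w) = (\<Sum>w\<in>H. prob (E w))"
    using fin(2) E_ev
    by (intro finite_measure_finite_Union) (auto simp: disjoint_family_on_def E_def F_def)
  ultimately have "prob (\<Union>w\<in>H. E w) = card H * ((N / card G) * (N / card G))"
    by simp
  also have "\<dots> = 1 / card H"
    using G card_G by (simp add: field_simps)
  finally show "\<P>(\<omega> in M. f (X \<omega>) = f (Y \<omega>)) = 1 / card H"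
    by (simp add: un)
qed

section \<open>The two limits\<close>

theorem lemma3p4:
  fixes T :: "'v pair_pre_digraph" and root :: 'v
    and M :: "nat \<Rightarrow> 'a measure" and U V :: "nat \<Rightarrow> 'a \<Rightarrow> 'v"
  assumes tree: "rooted_tree T root"
    and infinite_tree: "infinite (pverts T)"
    and loc_finite: "rooted_tree.locally_finite T"
    and spherical: "rooted_tree.spherically_symmetric T root"
    and growth: "filterlim (\<lambda>n. card (rooted_tree.generation T root n)) at_top sequentially"
    and prob: "\<And>n. prob_space (M n)"
    and indep: "\<And>n. prob_space.indep_var (M n)
           (count_space (rooted_tree.generation T root n)) (U n)
           (count_space (rooted_tree.generation T root n)) (V n)"
    and uniform_U: "\<And>n. distr (M n) (count_space (rooted_tree.generation T root n)) (U n)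
           = uniform_count_measure (rooted_tree.generation T root n)"
    and uniform_V: "\<And>n. distr (M n) (count_space (rooted_tree.generation T root n)) (V n)
           = uniform_count_measure (rooted_tree.generation T root n)"
  shows "(\<forall>k :: nat. (\<lambda>n. \<P>(\<omega> in M n. rooted_tree.tree_dist T (U n \<omega>) (V n \<omega>) \<le> k))
             \<longlonglongrightarrow> 0)
       \<and> (\<forall>\<epsilon> > 0. \<exists>k :: nat. \<forall>\<^sub>F n in sequentially.
             \<P>(\<omega> in M n. rooted_tree.height T root
                 (rooted_tree.latest_common_ancestor T root (U n \<omega>) (V n \<omega>)) > k) < \<epsilon>)"
proof -
  interpret rooted_tree T root by (fact tree)
  \<comment> \<open>Common to both claims: \<open>P\<close> is any relation that forces agreement at
    height \<open>j\<close>. It is applied with \<open>j = n - k\<close> to the distance and with a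
    fixed height to the latest common ancestor.\<close>
  have bound: "\<P>(\<omega> in M n. P (U n \<omega>) (V n \<omega>)) \<le> 1 / card (generation j)"
    if "j \<le> n" and P: "\<And>u v. u \<in> generation n \<Longrightarrow> v \<in> generation n \<Longrightarrow> P u v
      \<Longrightarrow> ancestor_at j u = ancestor_at j v" for j n P
  proof -
    interpret prob_space "M n" by (fact prob)
    obtain N where N: "card {v \<in> generation n. ancestor_at j v = w} = N" if "w \<in> generation j" for w
      using card_descendants[OF spherical, of j "n - j"] \<open>j \<le> n\<close> by auto
    have "ancestor_at j ` generation n \<subseteq> generation j"
      using ancestor_at_generation \<open>j \<le> n\<close> by blast
    note eq = prob_equal_image_of_uniform[OF indep uniform_U uniform_V
      finite_generation[OF spherical] finite_generation[OF spherical] this N]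
    have "U n \<omega> \<in> generation n" "V n \<omega> \<in> generation n" if "\<omega> \<in> space (M n)" for \<omega>
      using measurable_space[OF indep_var_rv1[OF indep] that]
        measurable_space[OF indep_var_rv2[OF indep] that] by auto
    then have "\<P>(\<omega> in M n. P (U n \<omega>) (V n \<omega>))
        \<le> \<P>(\<omega> in M n. ancestor_at j (U n \<omega>) = ancestor_at j (V n \<omega>))"
      \<comment> \<open>Monotonicity asks for measurability of the larger event, which is
        \<open>eq(1)\<close>.\<close>
      using P by (intro finite_measure_mono eq(1)) auto
    then show ?thesis
      using eq(2) by simp
  qed
  have lim: "(\<lambda>n. 1 / real (card (generation n))) \<longlonglongrightarrow> 0"
    by (rule tendsto_divide_0[OF tendsto_const])
      (intro filterlim_at_top_imp_at_infinity filterlim_compose[OF filterlim_real_sequentially growth])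
  show ?thesis
  proof (intro conjI allI impI)
    fix k :: nat
    have "(\<lambda>n. 1 / real (card (generation (n - k)))) \<longlonglongrightarrow> 0"
      by (rule filterlim_compose[OF lim filterlim_minus_const_nat_at_top])
    then show "(\<lambda>n. \<P>(\<omega> in M n. tree_dist (U n \<omega>) (V n \<omega>) \<le> k)) \<longlonglongrightarrow> 0"
      by (rule tendsto_sandwich[OF _ _ tendsto_const, rotated 2])
        (auto intro!: always_eventually bound ancestor_at_eq_if_tree_dist_le)
  next
    fix \<epsilon> :: real
    assume "\<epsilon> > 0"
    then have "\<forall>\<^sub>F n in sequentially. 1 / real (card (generation n)) < \<epsilon>"
      using lim by (rule order_tendstoD(2)[rotated])
    \<comment> \<open>Height greater than \<open>j\<close> forces agreement at height
      \<open>Suc j\<close>, so that generation is the one to be made large; \<open>j\<close> then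
      serves as \<open>k\<close> for all \<open>n \<ge> Suc j\<close>.\<close>
    then obtain j where j: "1 / real (card (generation (Suc j))) < \<epsilon>"
      by (auto simp: eventually_sequentially) (meson le_SucI order_refl)
    have "\<P>(\<omega> in M n. height (latest_common_ancestor (U n \<omega>) (V n \<omega>)) > j) < \<epsilon>"
      if "n \<ge> Suc j" for n
    proof -
      have "\<P>(\<omega> in M n. height (latest_common_ancestor (U n \<omega>) (V n \<omega>)) > j)
          \<le> 1 / card (generation (Suc j))"
        by (rule bound[OF that]) (auto simp: generation_def intro: ancestor_at_eq_if_latest_common_ancestor)
      with j show ?thesis by simp
    qed
    then show "\<exists>k. \<forall>\<^sub>F n in sequentially.
        \<P>(\<omega> in M n. height (latest_common_ancestor (U n \<omega>) (V n \<omega>)) > k) < \<epsilon>"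
      unfolding eventually_sequentially by blast
  qed
qed

end
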